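(* For every pair $a,b$ of integers with $2\leq a\leq b$, there exists a connected graph $G$ with $\dim(G)=a$ and $\dim^+(G)=b$.
   Context: Graphs are finite and simple; $d(u,v)$ is the length of a shortest $u$-$v$ path. A vertex $w$ resolves a pair $\{x,y\}$ if $d(w,x)\neq d(w,y)$. A set $S\subseteq V(G)$ is a resolving set if every pair of vertices is resolved by some vertex of $S$. The metric dimension $\dim(G)$ is the minimum size of a resolving set. A resolving set is minimal if no proper subset of it is a resolving set; the upper dimension $\dim^+(G)$ is the maximum size of a minimal resolving set. *)

theory Defs
  imports "Graph_Theory.Graph_Theory" "HOL-Library.Extended_Nat"
begin

text \<open>
  Finite simple graphs are rendered by the locale \<^locale>\<open>pair_graph\<close>: an undirected edge is a
  pair of opposite arcs, so the length of a path is its number of arcs. The distance is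
  \<^term>\<open>\<infinity>\<close> if there is no path.
\<close>

definition graph_dist :: "('a, 'b) pre_digraph \<Rightarrow> 'a \<Rightarrow> 'a \<Rightarrow> enat" where
  "graph_dist G u v = (INF p \<in> {p. pre_digraph.apath G u p v}. enat (length p))"

definition resolves :: "('a, 'b) pre_digraph \<Rightarrow> 'a \<Rightarrow> 'a \<Rightarrow> 'a \<Rightarrow> bool" where
  "resolves G w x y \<longleftrightarrow> graph_dist G w x \<noteq> graph_dist G w y"

definition resolving_set :: "('a, 'b) pre_digraph \<Rightarrow> 'a set \<Rightarrow> bool" where
  "resolving_set G S \<longleftrightarrow> S \<subseteq> verts G \<and>
    (\<forall>x \<in> verts G. \<forall>y \<in> verts G. x \<noteq> y \<longrightarrow> (\<exists>w \<in> S. resolves G w x y))"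

definition minimal_resolving_set :: "('a, 'b) pre_digraph \<Rightarrow> 'a set \<Rightarrow> bool" where
  "minimal_resolving_set G S \<longleftrightarrow> resolving_set G S \<and> (\<forall>T. T \<subset> S \<longrightarrow> \<not> resolving_set G T)"

text \<open>
  If \<^term>\<open>verts G\<close> is finite, the sets below are finite and nonempty, since \<^term>\<open>verts G\<close> is
  itself a resolving set.
\<close>

definition metric_dim :: "('a, 'b) pre_digraph \<Rightarrow> nat" where
  "metric_dim G = Min (card ` {S. resolving_set G S})"

definition upper_dim :: "('a, 'b) pre_digraph \<Rightarrow> nat" where
  "upper_dim G = Max (card ` {S. minimal_resolving_set G S})"

end

theory Submission
  imports Defs
begin

text \<open>
  Let \<open>k = b - a + 1\<close>. A hub and \<open>a\<close> twins form a clique. The hub is also joined to \<open>Inner 0\<close> and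
  \<open>Outer 0\<close>, where \<open>Inner 0, \<dots>, Inner k\<close> is a path and \<open>Outer (-k), \<dots>, Outer k\<close> is a path folded
  at its middle, so that \<open>Inner i\<close>, \<open>Outer i\<close> and \<open>Outer (-i)\<close> lie at the same height \<open>i\<close>. At each
  height \<open>i > 0\<close> a rung joins \<open>Inner i\<close> to exactly one of \<open>Outer i\<close> and \<open>Outer (-i)\<close>, on alternating
  sides.

  Every resolving set contains all but at most one twin, and one twin tells all heights apart. Any
  vertex of the two paths separates \<open>Inner i\<close> from \<open>Outer i\<close> and \<open>Outer (-i)\<close>, so the remaining
  difficulty is to separate \<open>Outer i\<close> from \<open>Outer (-i)\<close>: every \<open>Outer t\<close> with \<open>t \<noteq> 0\<close> does so for
  all \<open>i\<close> at once, whereas \<open>Inner j\<close>, which reaches either side at equal cost once it moves by a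
  level, does so for \<open>i = j\<close> only. Hence the minimal resolving sets consist of \<open>a - 1\<close> twins and
  either a single \<open>Outer t\<close> or all of \<open>Inner 1, \<dots>, Inner k\<close>, which gives the sizes \<open>a\<close> and
  \<open>a - 1 + k = b\<close>.
\<close>

section \<open>Distances in digraphs\<close>

context wf_digraph
begin

lemma potential_le_length_awalk:
  fixes f :: "'a \<Rightarrow> nat"
  assumes lipschitz: "\<And>e. e \<in> arcs G \<Longrightarrow> f (tail G e) \<le> Suc (f (head G e))"
    and "awalk u p v"
  shows "f u \<le> f v + length p"
  using assms(2)
proof (induction p arbitrary: u)
  case Nil
  then show ?case by (simp add: awalk_Nil_iff)
next
  case (Cons e p)
  then have "e \<in> arcs G" "u = tail G e" "f (head G e) \<le> f v + length p"
    by (auto simp: awalk_Cons_iff)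
  with lipschitz[of e] show ?case by simp
qed

lemma apath_along_descending_potential:
  fixes f :: "'a \<Rightarrow> nat"
  assumes lipschitz: "\<And>e. e \<in> arcs G \<Longrightarrow> f (tail G e) \<le> Suc (f (head G e))"
    and descent: "\<And>u. u \<in> verts G \<Longrightarrow> u \<noteq> v \<Longrightarrow> \<exists>e\<in>arcs G. tail G e = u \<and> f (head G e) < f u"
    and "u \<in> verts G"
  shows "\<exists>p. apath u p v \<and> f u = f v + length p \<and> (\<forall>w\<in>set (awalk_verts u p). f w \<le> f u)"
  using assms(3)
proof (induction "f u" arbitrary: u rule: less_induct)
  case less
  show ?case
  proof (cases "u = v")
    case True
    with less.prems show ?thesis by (intro exI[of _ "[]"]) (simp add: apath_Nil_iff)
  next
    case False
    with less.prems descent obtain e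
      where e: "e \<in> arcs G" "tail G e = u" "f (head G e) < f u"
      by blast
    with lipschitz[of e] have "f u = Suc (f (head G e))" by simp
    moreover obtain p where "apath (head G e) p v" "f (head G e) = f v + length p"
      "\<forall>w\<in>set (awalk_verts (head G e) p). f w \<le> f (head G e)"
      using less.hyps[OF e(3)] e(1) by auto
    ultimately show ?thesis
      using e by (intro exI[of _ "e # p"]) (force simp: apath_Cons_iff)
  qed
qed

lemma graph_dist_eqI:
  fixes f :: "'a \<Rightarrow> nat"
  assumes "f v = 0"
    and lipschitz: "\<And>e. e \<in> arcs G \<Longrightarrow> f (tail G e) \<le> Suc (f (head G e))"
    and descent: "\<And>u. u \<in> verts G \<Longrightarrow> u \<noteq> v \<Longrightarrow> \<exists>e\<in>arcs G. tail G e = u \<and> f (head G e) < f u"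
    and "u \<in> verts G"
  shows "graph_dist G u v = enat (f u)"
proof -
  obtain p where "apath u p v" "length p = f u"
    using apath_along_descending_potential[of f v u] assms by fastforce
  moreover have "f u \<le> length p" if "apath u p v" for p
    using potential_le_length_awalk[OF lipschitz awalkI_apath[OF that]] \<open>f v = 0\<close> by simp
  ultimately show ?thesis
    unfolding graph_dist_def by (intro antisym INF_greatest) (auto intro!: INF_lower2[of p])
qed

lemma connected_if_graph_dist_finite:
  assumes "verts G \<noteq> {}" and "\<And>u v. u \<in> verts G \<Longrightarrow> v \<in> verts G \<Longrightarrow> graph_dist G u v \<noteq> \<infinity>"
  shows "connected G"
proof -
  have "u \<rightarrow>\<^sup>* v" if "u \<in> verts G" "v \<in> verts G" for u v
  proof -
    have "{p. apath u p v} \<noteq> {}"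
    proof
      assume "{p. apath u p v} = {}"
      then have "graph_dist G u v = \<infinity>" by (simp add: graph_dist_def top_enat_def)
      with assms(2)[OF that] show False by simp
    qed
    then show ?thesis by (auto simp: reachable_apath)
  qed
  with assms(1) show ?thesis
    unfolding connected_def by (intro strongly_connectedI reachable_mk_symmetricI) auto
qed

end


section \<open>Isomorphism invariance\<close>

lemma psubset_image_iff:
  assumes "inj_on f S"
  shows "T \<subset> f ` S \<longleftrightarrow> (\<exists>R. R \<subset> S \<and> T = f ` R)"
proof
  assume "T \<subset> f ` S"
  then obtain R where "R \<subseteq> S" "T = f ` R"
    by (auto simp: psubset_eq subset_image_iff)
  with \<open>T \<subset> f ` S\<close> show "\<exists>R. R \<subset> S \<and> T = f ` R" by blast
next
  assume "\<exists>R. R \<subset> S \<and> T = f ` R"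
  then show "T \<subset> f ` S"
    by (elim exE conjE) (simp only: image_strict_mono[OF assms])
qed

lemma Collect_eq_image_Collect:
  assumes "\<And>S. S \<subseteq> A \<Longrightarrow> Q (f ` S) \<longleftrightarrow> P S"
    and "\<And>S. P S \<Longrightarrow> S \<subseteq> A" "\<And>T. Q T \<Longrightarrow> T \<subseteq> f ` A"
  shows "{T. Q T} = (`) f ` {S. P S}"
proof (intro equalityI subsetI)
  fix T assume "T \<in> {T. Q T}"
  moreover from this obtain S where "S \<subseteq> A" "T = f ` S"
    using assms(3)[of T] by (auto simp: subset_image_iff)
  ultimately show "T \<in> (`) f ` {S. P S}"
    using assms(1) by simp
next
  fix T assume "T \<in> (`) f ` {S. P S}"
  then obtain S where "P S" "T = f ` S" by auto
  with assms(1)[of S] assms(2)[of S] show "T \<in> {T. Q T}" by simp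
qed

context wf_digraph
begin

lemma graph_dist_app_iso_le:
  assumes hom: "digraph_isomorphism hom"
  shows "graph_dist (app_iso hom G) (iso_verts hom u) (iso_verts hom v) \<le> graph_dist G u v"
proof -
  interpret H: wf_digraph "app_iso hom G" using hom ..
  have "H.apath (iso_verts hom u) (map (iso_arcs hom) p) (iso_verts hom v)" if "apath u p v" for p
  proof -
    have "set (awalk_verts u p) \<subseteq> verts G"
      using awalkI_apath[OF that] awalk_verts_in_verts by (auto simp: awalk_def)
    then have "inj_on (iso_verts hom) (set (awalk_verts u p))"
      by (rule inj_on_subset[OF digraph_isomorphism_inj_on_verts[OF hom]])
    with that hom show ?thesis
      using awalk_verts_app_iso_eq[OF hom awalkI_apath[OF that]]
      unfolding apath_def H.apath_def by (simp add: awalk_app_isoI distinct_map)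
  qed
  then show ?thesis
    unfolding graph_dist_def by (intro INF_mono) (metis length_map mem_Collect_eq order_refl)
qed

lemma graph_dist_app_iso:
  assumes hom: "digraph_isomorphism hom" and "u \<in> verts G" "v \<in> verts G"
  shows "graph_dist (app_iso hom G) (iso_verts hom u) (iso_verts hom v) = graph_dist G u v"
proof (rule antisym)
  interpret H: wf_digraph "app_iso hom G" using hom ..
  show "graph_dist G u v \<le> graph_dist (app_iso hom G) (iso_verts hom u) (iso_verts hom v)"
    using H.graph_dist_app_iso_le[OF digraph_isomorphism_invI[OF hom],
        of "iso_verts hom u" "iso_verts hom v"] assms
    by simp
qed (rule graph_dist_app_iso_le[OF hom])

lemma resolving_set_app_iso:
  assumes hom: "digraph_isomorphism hom" and "S \<subseteq> verts G"
  shows "resolving_set (app_iso hom G) (iso_verts hom ` S) \<longleftrightarrow> resolving_set G S"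
proof -
  have "resolves (app_iso hom G) (iso_verts hom w) (iso_verts hom x) (iso_verts hom y)
      \<longleftrightarrow> resolves G w x y" if "w \<in> S" "x \<in> verts G" "y \<in> verts G" for w x y
    using that assms by (auto simp: resolves_def graph_dist_app_iso)
  with assms show ?thesis
    by (auto simp: resolving_set_def)
qed

lemma minimal_resolving_set_app_iso:
  assumes hom: "digraph_isomorphism hom" and "S \<subseteq> verts G"
  shows "minimal_resolving_set (app_iso hom G) (iso_verts hom ` S) \<longleftrightarrow> minimal_resolving_set G S"
proof -
  have inj: "inj_on (iso_verts hom) S"
    using assms digraph_isomorphism_inj_on_verts inj_on_subset by blast
  have "resolving_set (app_iso hom G) (iso_verts hom ` T) \<longleftrightarrow> resolving_set G T"
    if "T \<subset> S" for T
    using that assms by (intro resolving_set_app_iso) auto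
  then show ?thesis
    unfolding minimal_resolving_set_def psubset_image_iff[OF inj]
    using resolving_set_app_iso[OF assms] by blast
qed

lemma card_iso_verts_image:
  assumes "digraph_isomorphism hom" "S \<subseteq> verts G"
  shows "card (iso_verts hom ` S) = card S"
  by (rule card_image[OF inj_on_subset[OF digraph_isomorphism_inj_on_verts[OF assms(1)] assms(2)]])

lemma metric_dim_app_iso:
  assumes hom: "digraph_isomorphism hom"
  shows "metric_dim (app_iso hom G) = metric_dim G"
proof -
  have subset: "S \<subseteq> verts G" if "resolving_set G S" for S
    using that by (simp add: resolving_set_def)
  have "{T. resolving_set (app_iso hom G) T} = (`) (iso_verts hom) ` {S. resolving_set G S}"
    using resolving_set_app_iso[OF hom] subset
    by (intro Collect_eq_image_Collect[of "verts G"]) (auto simp: resolving_set_def[of "app_iso hom G"])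
  with card_iso_verts_image[OF hom subset] show ?thesis
    by (simp add: metric_dim_def image_image)
qed

lemma upper_dim_app_iso:
  assumes hom: "digraph_isomorphism hom"
  shows "upper_dim (app_iso hom G) = upper_dim G"
proof -
  have subset: "S \<subseteq> verts G" if "minimal_resolving_set G S" for S
    using that by (simp add: minimal_resolving_set_def resolving_set_def)
  have "{T. minimal_resolving_set (app_iso hom G) T}
      = (`) (iso_verts hom) ` {S. minimal_resolving_set G S}"
    using minimal_resolving_set_app_iso[OF hom] subset
    by (intro Collect_eq_image_Collect[of "verts G"])
      (auto simp: minimal_resolving_set_def[of "app_iso hom G"]
        resolving_set_def[of "app_iso hom G"])
  with card_iso_verts_image[OF hom subset] show ?thesis
    by (simp add: upper_dim_def image_image)
qed

corollary metric_dim_digraph_iso: "digraph_iso G H \<Longrightarrow> metric_dim H = metric_dim G"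
  by (auto simp: digraph_iso_def metric_dim_app_iso)

corollary upper_dim_digraph_iso: "digraph_iso G H \<Longrightarrow> upper_dim H = upper_dim G"
  by (auto simp: digraph_iso_def upper_dim_app_iso)

end

definition relabel :: "('a \<Rightarrow> 'b) \<Rightarrow> 'a pair_pre_digraph \<Rightarrow> 'b pair_pre_digraph" where
  "relabel f G = \<lparr>pverts = f ` pverts G, parcs = map_prod f f ` parcs G\<rparr>"

lemma with_proj_relabel:
  "with_proj (relabel f G) =
    app_iso \<lparr>iso_verts = f, iso_arcs = map_prod f f, iso_head = snd, iso_tail = fst\<rparr> (with_proj G)"
  unfolding with_proj_def relabel_def app_iso_def by simp

lemma pair_graph_relabel:
  assumes "pair_graph G" "inj_on f (pverts G)"
  shows "pair_graph (relabel f G)"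
proof -
  interpret pair_graph G by fact
  show ?thesis
  proof
    fix e assume "e \<in> parcs (relabel f G)"
    then obtain u v where "(u, v) \<in> parcs G" "e = (f u, f v)"
      by (auto simp: relabel_def)
    moreover from this have "u \<in> pverts G" "v \<in> pverts G"
      using in_arcsD1 in_arcsD2 by blast+
    ultimately show "fst e \<in> pverts (relabel f G)" "snd e \<in> pverts (relabel f G)" "fst e \<noteq> snd e"
      using pair_no_loops[of "(u, v)"] assms(2) by (auto simp: relabel_def inj_on_eq_iff)
  next
    show "finite (pverts (relabel f G))" "finite (parcs (relabel f G))"
      by (simp_all add: relabel_def)
    show "symmetric (with_proj (relabel f G))"
      using pair_sym_arcs by (fastforce simp: symmetric_def relabel_def sym_def)
  qed
qed

lemma (in pair_wf_digraph) digraph_iso_relabel: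
  assumes "inj_on f (pverts G)"
  shows "digraph_iso (with_proj G) (with_proj (relabel f G))"
proof -
  let ?hom = "\<lparr>iso_verts = f, iso_arcs = map_prod f f, iso_head = snd, iso_tail = fst\<rparr>"
  have "inj_on (map_prod f f) (parcs G)"
    by (rule inj_on_subset[OF map_prod_inj_on[OF assms assms]]) (auto dest: in_arcsD1 in_arcsD2)
  then have "digraph_isomorphism ?hom"
    using assms by (simp add: digraph_isomorphism_def wf_digraph_axioms)
  then show ?thesis
    unfolding digraph_iso_def with_proj_relabel by blast
qed

lemma ex_iso_nat_pair_graph:
  assumes "pair_graph G"
  shows "\<exists>H :: nat pair_pre_digraph. pair_graph H \<and> digraph_iso (with_proj G) (with_proj H)"
proof -
  interpret pair_graph G by fact
  obtain f :: "'a \<Rightarrow> nat" where "inj_on f (pverts G)"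
    using finite_imp_inj_to_nat_seg[OF pair_finite_verts] by blast
  with assms show ?thesis
    using pair_graph_relabel digraph_iso_relabel by blast
qed


section \<open>Generating families of resolving sets\<close>

definition resolving_sets_generated_by :: "('a, 'b) pre_digraph \<Rightarrow> 'a set set \<Rightarrow> bool" where
  "resolving_sets_generated_by G \<B> \<longleftrightarrow> \<B> \<subseteq> Pow (verts G) \<and>
    (\<forall>S. resolving_set G S \<longleftrightarrow> S \<subseteq> verts G \<and> (\<exists>B\<in>\<B>. B \<subseteq> S))"

lemma metric_dim_eq_Min_generators:
  assumes gen: "resolving_sets_generated_by G \<B>" and "\<B> \<noteq> {}" and "finite (verts G)"
  shows "metric_dim G = Min (card ` \<B>)"
  unfolding metric_dim_def
proof (rule Min_eqI)
  have "finite \<B>"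
    using gen assms(3) unfolding resolving_sets_generated_by_def
    by (meson finite_Pow_iff finite_subset)
  then have "Min (card ` \<B>) \<in> card ` \<B>"
    using assms(2) by (intro Min_in) auto
  moreover have "\<B> \<subseteq> {S. resolving_set G S}"
    using gen by (auto simp: resolving_sets_generated_by_def)
  ultimately show "Min (card ` \<B>) \<in> card ` {S. resolving_set G S}"
    by blast
  have "finite {S. resolving_set G S}"
    by (rule finite_subset[of _ "Pow (verts G)"]) (auto simp: resolving_set_def assms(3))
  then show "finite (card ` {S. resolving_set G S})"
    by (rule finite_imageI)
  fix n assume "n \<in> card ` {S. resolving_set G S}"
  then obtain S B where "n = card S" "S \<subseteq> verts G" "B \<in> \<B>" "B \<subseteq> S"
    using gen by (auto simp: resolving_sets_generated_by_def)
  moreover from this have "card B \<le> card S"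
    using assms(3) by (meson card_mono finite_subset)
  moreover have "Min (card ` \<B>) \<le> card B"
    using \<open>finite \<B>\<close> \<open>B \<in> \<B>\<close> by simp
  ultimately show "Min (card ` \<B>) \<le> n" by simp
qed

lemma minimal_resolving_sets_eq_generators:
  assumes gen: "resolving_sets_generated_by G \<B>"
    and antichain: "\<And>B C. B \<in> \<B> \<Longrightarrow> C \<in> \<B> \<Longrightarrow> B \<subseteq> C \<Longrightarrow> B = C"
  shows "{S. minimal_resolving_set G S} = \<B>"
proof (intro equalityI subsetI CollectI)
  have resolving: "resolving_set G S \<longleftrightarrow> S \<subseteq> verts G \<and> (\<exists>B\<in>\<B>. B \<subseteq> S)" for S
    using gen by (simp add: resolving_sets_generated_by_def)
  have generator: "resolving_set G B" if "B \<in> \<B>" for B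
    using that gen by (auto simp: resolving_sets_generated_by_def)
  show "S \<in> \<B>" if "S \<in> {S. minimal_resolving_set G S}" for S
  proof -
    from that have minimal: "resolving_set G S" "\<And>T. T \<subset> S \<Longrightarrow> \<not> resolving_set G T"
      by (simp_all add: minimal_resolving_set_def)
    then obtain B where "B \<in> \<B>" "B \<subseteq> S"
      by (auto simp: resolving)
    with minimal(2)[of B] generator have "B = S" by blast
    with \<open>B \<in> \<B>\<close> show ?thesis by simp
  qed
  show "minimal_resolving_set G S" if "S \<in> \<B>" for S
  proof -
    have "\<not> resolving_set G T" if "T \<subset> S" for T
    proof
      assume "resolving_set G T"
      then obtain B where "B \<in> \<B>" "B \<subseteq> T"
        by (auto simp: resolving)
      with antichain[of B S] \<open>S \<in> \<B>\<close> \<open>T \<subset> S\<close> show False by blast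
    qed
    with generator[OF \<open>S \<in> \<B>\<close>] show ?thesis
      by (simp add: minimal_resolving_set_def)
  qed
qed

corollary upper_dim_eq_Max_generators:
  assumes "resolving_sets_generated_by G \<B>"
    and "\<And>B C. B \<in> \<B> \<Longrightarrow> C \<in> \<B> \<Longrightarrow> B \<subseteq> C \<Longrightarrow> B = C"
  shows "upper_dim G = Max (card ` \<B>)"
  using minimal_resolving_sets_eq_generators[OF assms] by (simp only: upper_dim_def)


section \<open>The folded ladder\<close>

datatype vertex = Twin nat | Hub | Inner nat | Outer int

definition height :: "int \<Rightarrow> nat" where
  "height t = nat \<bar>t\<bar>"

definition has_rung :: "int \<Rightarrow> bool" where
  "has_rung t \<longleftrightarrow> (even t \<longleftrightarrow> 0 \<le> t)"

fun adj :: "vertex \<Rightarrow> vertex \<Rightarrow> bool" where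
  "adj (Twin i) (Twin j) \<longleftrightarrow> i \<noteq> j"
| "adj (Twin _) Hub \<longleftrightarrow> True"
| "adj Hub (Twin _) \<longleftrightarrow> True"
| "adj Hub (Inner i) \<longleftrightarrow> i = 0"
| "adj (Inner i) Hub \<longleftrightarrow> i = 0"
| "adj Hub (Outer t) \<longleftrightarrow> t = 0"
| "adj (Outer t) Hub \<longleftrightarrow> t = 0"
| "adj (Inner i) (Inner j) \<longleftrightarrow> i = Suc j \<or> j = Suc i"
| "adj (Outer s) (Outer t) \<longleftrightarrow> \<bar>s - t\<bar> = 1"
| "adj (Inner i) (Outer t) \<longleftrightarrow> height t = i \<and> has_rung t"
| "adj (Outer t) (Inner i) \<longleftrightarrow> height t = i \<and> has_rung t"
| "adj _ _ \<longleftrightarrow> False"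

definition ladder_verts :: "nat \<Rightarrow> nat \<Rightarrow> vertex set" where
  "ladder_verts a k = Twin ` {..<a} \<union> {Hub} \<union> Inner ` {..k} \<union> Outer ` {- int k..int k}"

definition ladder :: "nat \<Rightarrow> nat \<Rightarrow> vertex pair_pre_digraph" where
  "ladder a k = \<lparr>pverts = ladder_verts a k,
    parcs = {(u, v). u \<in> ladder_verts a k \<and> v \<in> ladder_verts a k \<and> adj u v}\<rparr>"

lemma ladder_verts_iff [simp]:
  "Twin i \<in> ladder_verts a k \<longleftrightarrow> i < a"
  "Hub \<in> ladder_verts a k"
  "Inner i \<in> ladder_verts a k \<longleftrightarrow> i \<le> k"
  "Outer t \<in> ladder_verts a k \<longleftrightarrow> height t \<le> k"
  by (auto simp: ladder_verts_def height_def image_iff)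

lemma finite_ladder_verts: "finite (ladder_verts a k)"
  by (simp add: ladder_verts_def)

lemma pverts_ladder [simp]: "pverts (ladder a k) = ladder_verts a k"
  and parcs_ladder_iff:
    "(u, v) \<in> parcs (ladder a k) \<longleftrightarrow> u \<in> ladder_verts a k \<and> v \<in> ladder_verts a k \<and> adj u v"
  by (simp_all add: ladder_def)

lemma adj_irrefl: "\<not> adj u u"
  by (cases u) auto

lemma adj_sym: "adj u v \<Longrightarrow> adj v u"
  by (cases u; cases v) auto

lemma pair_graph_ladder: "pair_graph (ladder a k)"
proof
  have "parcs (ladder a k) \<subseteq> ladder_verts a k \<times> ladder_verts a k"
    by (auto simp: parcs_ladder_iff)
  then show "finite (parcs (ladder a k))"
    by (rule finite_subset) (simp add: finite_ladder_verts)
  show "symmetric (with_proj (ladder a k))"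
    by (auto simp: symmetric_def parcs_ladder_iff intro!: symI dest: adj_sym)
qed (auto simp: parcs_ladder_iff finite_ladder_verts adj_irrefl)


section \<open>Distances in the folded ladder\<close>

subsection \<open>The distance function\<close>

definition gap :: "nat \<Rightarrow> nat \<Rightarrow> nat" where
  "gap i j = nat \<bar>int i - int j\<bar>"

definition inner_outer_dist :: "nat \<Rightarrow> int \<Rightarrow> nat" where
  "inner_outer_dist i t =
    (if i = height t \<and> \<not> has_rung t then 3 else gap i (height t) + 1)"

text \<open>
  A walk that crosses from one side of the outer path to the other uses two rungs. If the heights
  of its ends differ by at most \<open>1\<close> and an end has no rung, then it has to leave the range of heights
  between them, which costs two more steps.
\<close>

definition crossing_dist :: "int \<Rightarrow> int \<Rightarrow> nat" where
  "crossing_dist s t = gap (height s) (height t) +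
    (if gap (height s) (height t) \<le> 1 \<and> \<not> (has_rung s \<and> has_rung t) then 4 else 2)"

definition outer_dist :: "int \<Rightarrow> int \<Rightarrow> nat" where
  "outer_dist s t = min (nat \<bar>s - t\<bar>) (crossing_dist s t)"

fun level :: "vertex \<Rightarrow> nat" where
  "level (Twin _) = 0"
| "level Hub = 1"
| "level (Inner i) = i + 2"
| "level (Outer t) = height t + 2"

fun dst :: "vertex \<Rightarrow> vertex \<Rightarrow> nat" where
  "dst (Twin i) (Twin j) = (if i = j then 0 else 1)"
| "dst (Inner i) (Outer t) = inner_outer_dist i t"
| "dst (Outer t) (Inner i) = inner_outer_dist i t"
| "dst (Outer s) (Outer t) = outer_dist s t"
| "dst u v = gap (level u) (level v)"

lemma gap_self [simp]: "gap i i = 0"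
  and gap_0 [simp]: "gap 0 i = i" "gap i 0 = i"
  and gap_Suc_Suc [simp]: "gap (Suc i) (Suc j) = gap i j"
  and gap_eq_0_iff [simp]: "gap i j = 0 \<longleftrightarrow> i = j"
  by (simp_all add: gap_def)

lemma gap_commute: "gap i j = gap j i"
  by (simp add: gap_def abs_minus_commute)

lemma gap_step:
  "i = Suc j \<or> j = Suc i \<Longrightarrow> gap i n = Suc (gap j n) \<or> gap j n = Suc (gap i n)"
  unfolding gap_def by arith

lemma gap_step_le: "i = Suc j \<or> j = Suc i \<Longrightarrow> gap i n \<le> Suc (gap j n)"
  using gap_step[of i j n] by auto

lemma even_gap_iff: "even (gap i j) \<longleftrightarrow> (even i \<longleftrightarrow> even j)"
  by (simp add: gap_def even_nat_iff)

lemma height_0 [simp]: "height 0 = 0"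
  and height_minus [simp]: "height (- t) = height t"
  and height_pos_iff [simp]: "0 < height t \<longleftrightarrow> t \<noteq> 0"
  by (auto simp: height_def)

lemma height_eq_iff: "height s = height t \<longleftrightarrow> s = t \<or> s = - t"
  by (auto simp: height_def)

lemma even_height_iff: "even (height t) \<longleftrightarrow> even t"
  by (simp add: height_def even_nat_iff)

lemma height_step: "\<bar>s - t\<bar> = 1 \<Longrightarrow> height s = Suc (height t) \<or> height t = Suc (height s)"
  unfolding height_def by linarith

lemma gap_height: "gap (height s) (height t) = nat \<bar>\<bar>s\<bar> - \<bar>t\<bar>\<bar>"
  by (simp add: gap_def height_def)

lemma gap_height_le: "gap (height s) (height t) \<le> nat \<bar>s - t\<bar>"
  unfolding gap_height by (intro nat_mono abs_triangle_ineq3)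

lemma gap_height_same_side:
  "0 \<le> s \<longleftrightarrow> 0 \<le> t \<Longrightarrow> gap (height s) (height t) = nat \<bar>s - t\<bar>"
  unfolding gap_height by (cases "0 \<le> s") (simp_all add: abs_minus_commute)

lemma has_rung_0 [simp]: "has_rung 0"
  by (simp add: has_rung_def)

lemma has_rung_minus: "t \<noteq> 0 \<Longrightarrow> has_rung (- t) \<longleftrightarrow> \<not> has_rung t"
  by (auto simp: has_rung_def)

lemma has_rung_iff_opposite_side:
  "0 \<le> s \<longleftrightarrow> \<not> 0 \<le> t \<Longrightarrow> (has_rung s \<longleftrightarrow> has_rung t) \<longleftrightarrow> odd (gap (height s) (height t))"
  by (auto simp: has_rung_def even_gap_iff even_height_iff)

lemma gap_less_inner_outer_dist: "gap i (height t) < inner_outer_dist i t"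
  by (simp add: inner_outer_dist_def)

lemma inner_outer_dist_0 [simp]:
  "inner_outer_dist 0 t = Suc (height t)" "inner_outer_dist i 0 = Suc i"
  by (auto simp: inner_outer_dist_def)

lemma inner_outer_dist_rung [simp]:
  "has_rung t \<Longrightarrow> inner_outer_dist i t = Suc (gap (height t) i)"
  by (simp add: inner_outer_dist_def gap_commute)

lemma gap_height_le_crossing_dist: "gap (height s) (height t) + 2 \<le> crossing_dist s t"
  by (simp add: crossing_dist_def)

lemma outer_dist_le: "outer_dist s t \<le> nat \<bar>s - t\<bar>"
  by (simp add: outer_dist_def)

lemma outer_dist_same_side:
  "0 \<le> s \<longleftrightarrow> 0 \<le> t \<Longrightarrow> outer_dist s t = nat \<bar>s - t\<bar>"
  using gap_height_same_side[of s t] by (simp add: outer_dist_def crossing_dist_def)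

lemma outer_dist_near_0:
  assumes "\<bar>s\<bar> \<le> 1"
  shows "outer_dist s t = nat \<bar>s - t\<bar>"
proof -
  have "nat \<bar>s - t\<bar> \<le> gap (height s) (height t) + 2"
    using assms unfolding gap_height by linarith
  with gap_height_le_crossing_dist[of s t] show ?thesis
    unfolding outer_dist_def by linarith
qed

lemma outer_dist_0 [simp]: "outer_dist 0 t = height t"
  by (simp add: outer_dist_near_0 height_def)

lemma dst_self [simp]: "dst u u = 0"
  by (cases u) (simp_all add: outer_dist_same_side)


subsection \<open>The Lipschitz property\<close>

lemma inner_outer_dist_inner_step:
  assumes "i = Suc j \<or> j = Suc i"
  shows "inner_outer_dist i t \<le> Suc (inner_outer_dist j t)"
  using assms gap_step[OF assms, of "height t"] unfolding inner_outer_dist_def by auto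

lemma inner_outer_dist_outer_step:
  assumes "\<bar>s - t\<bar> = 1"
  shows "inner_outer_dist i s \<le> Suc (inner_outer_dist i t)"
  using height_step[OF assms] gap_step[of "height s" "height t" i]
  unfolding inner_outer_dist_def gap_commute[of i] by auto

lemma crossing_dist_step:
  assumes "\<bar>s - s'\<bar> = 1" "0 \<le> s \<longleftrightarrow> 0 \<le> s'" "0 \<le> s \<longleftrightarrow> \<not> 0 \<le> t"
  shows "crossing_dist s t \<le> Suc (crossing_dist s' t)"
proof -
  define g g' where "g = gap (height s) (height t)" and "g' = gap (height s') (height t)"
  have "g = Suc g' \<or> g' = Suc g"
    using gap_step[OF height_step[OF assms(1)]] unfolding g_def g'_def by blast
  moreover have "(has_rung s \<longleftrightarrow> has_rung t) \<longleftrightarrow> odd g" "(has_rung s' \<longleftrightarrow> has_rung t) \<longleftrightarrow> odd g'"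
    using assms(2,3) unfolding g_def g'_def by (simp_all add: has_rung_iff_opposite_side)
  ultimately show ?thesis
    unfolding crossing_dist_def g_def[symmetric] g'_def[symmetric] by auto
qed

lemma outer_dist_step:
  assumes "\<bar>s - s'\<bar> = 1"
  shows "outer_dist s t \<le> Suc (outer_dist s' t)"
proof -
  have along: "nat \<bar>s - t\<bar> \<le> Suc (nat \<bar>s' - t\<bar>)"
    using assms by linarith
  consider (same_side) "0 \<le> s \<longleftrightarrow> 0 \<le> t"
    | (opposite_side) "0 \<le> s \<longleftrightarrow> 0 \<le> s'" "0 \<le> s \<longleftrightarrow> \<not> 0 \<le> t"
    | (near_0) "\<bar>s\<bar> \<le> 1" "\<bar>s'\<bar> \<le> 1"
    using assms by linarith
  then show ?thesis
  proof cases
    case same_side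
    have "nat \<bar>s - t\<bar> \<le> Suc (crossing_dist s' t)"
      using gap_height_same_side[OF same_side] gap_step_le[OF height_step[OF assms], of "height t"]
        gap_height_le_crossing_dist[of s' t]
      by linarith
    with along show ?thesis
      unfolding outer_dist_def by linarith
  next
    case opposite_side
    with along crossing_dist_step[OF assms] show ?thesis
      unfolding outer_dist_def by fastforce
  next
    case near_0
    with along show ?thesis
      by (simp add: outer_dist_near_0)
  qed
qed

lemma inner_outer_dist_le_outer_dist:
  assumes "has_rung t"
  shows "inner_outer_dist (height t) r \<le> Suc (outer_dist t r)"
proof -
  have "1 < nat \<bar>t - r\<bar>" if "height t = height r" "\<not> has_rung r"
  proof -
    have "r = - t" "t \<noteq> 0"
      using assms that by (auto simp: height_eq_iff)
    then show ?thesis by linarith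
  qed
  then show ?thesis
    using gap_height_le[of t r]
    unfolding inner_outer_dist_def outer_dist_def crossing_dist_def by auto
qed

lemma outer_dist_le_inner_outer_dist:
  assumes "has_rung t"
  shows "outer_dist t r \<le> Suc (inner_outer_dist (height t) r)"
proof (cases "0 \<le> t \<longleftrightarrow> 0 \<le> r")
  case True
  then show ?thesis
    using gap_less_inner_outer_dist[of "height t" r]
    by (simp add: outer_dist_same_side gap_height_same_side)
next
  case False
  then have "has_rung r \<longleftrightarrow> odd (gap (height t) (height r))"
    using has_rung_iff_opposite_side[of t r] assms by auto
  then have "crossing_dist t r \<le> Suc (inner_outer_dist (height t) r)"
    using assms unfolding inner_outer_dist_def crossing_dist_def by (auto simp: le_Suc_eq)
  then show ?thesis
    by (simp add: outer_dist_def)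
qed

lemma dst_Twin_step:
  "dst (Twin i) w \<le> Suc (dst (Twin j) w)"
  "dst (Twin i) w \<le> Suc (dst Hub w)"
  "dst Hub w \<le> Suc (dst (Twin i) w)"
  by (cases w; simp)+

lemma dst_Hub_step:
  "dst Hub w \<le> Suc (dst (Inner 0) w)"
  "dst (Inner 0) w \<le> Suc (dst Hub w)"
  "dst Hub w \<le> Suc (dst (Outer 0) w)"
  "dst (Outer 0) w \<le> Suc (dst Hub w)"
  by (cases w; simp)+

lemma dst_Inner_step:
  assumes "i = Suc j \<or> j = Suc i"
  shows "dst (Inner i) w \<le> Suc (dst (Inner j) w)"
  using assms by (cases w) (auto simp: gap_step_le inner_outer_dist_inner_step)

lemma dst_Outer_step:
  assumes "\<bar>s - t\<bar> = 1"
  shows "dst (Outer s) w \<le> Suc (dst (Outer t) w)"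
  using height_step[OF assms]
  by (cases w) (auto simp: inner_outer_dist_outer_step[OF assms] outer_dist_step[OF assms])

lemma dst_rung_step:
  assumes "has_rung t"
  shows "dst (Inner (height t)) w \<le> Suc (dst (Outer t) w)"
    and "dst (Outer t) w \<le> Suc (dst (Inner (height t)) w)"
  using inner_outer_dist_le_outer_dist[OF assms] outer_dist_le_inner_outer_dist[OF assms] assms
  by (cases w; simp)+

lemma dst_step: "adj u v \<Longrightarrow> dst u w \<le> Suc (dst v w)"
  by (cases u; cases v)
    (auto simp del: dst.simps
      intro: dst_Twin_step dst_Hub_step dst_Inner_step dst_Outer_step dst_rung_step)


subsection \<open>Descent towards a target\<close>

definition outer_at :: "int \<Rightarrow> nat \<Rightarrow> int" where
  "outer_at t n = (if 0 \<le> t then int n else - int n)"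

text \<open>
  For \<open>i = n\<close>, which is only needed where a rung is missing, this moves down, to a level where the
  rung is present.
\<close>

definition climb :: "nat \<Rightarrow> nat \<Rightarrow> nat" where
  "climb i n = (if i < n then Suc i else i - 1)"

fun toward :: "vertex \<Rightarrow> vertex \<Rightarrow> vertex" where
  "toward (Twin i) (Twin j) = Twin j"
| "toward (Twin i) _ = Hub"
| "toward Hub (Twin j) = Twin j"
| "toward Hub Hub = Hub"
| "toward Hub (Inner _) = Inner 0"
| "toward Hub (Outer _) = Outer 0"
| "toward (Inner i) (Inner j) = Inner (climb i j)"
| "toward (Inner i) (Outer t) =
    (if has_rung (outer_at t i) then Outer (outer_at t i) else Inner (climb i (height t)))"
| "toward (Inner i) _ = (if i = 0 then Hub else Inner (i - 1))"
| "toward (Outer s) (Inner i) =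
    (if has_rung s then Inner (height s) else Outer (outer_at s (climb (height s) i)))"
| "toward (Outer s) (Outer t) =
    (if outer_dist s t = nat \<bar>s - t\<bar> then Outer (s + sgn (t - s))
     else if has_rung s then Inner (height s)
     else Outer (outer_at s (climb (height s) (height t))))"
| "toward (Outer s) _ = (if s = 0 then Hub else Outer (outer_at s (height s - 1)))"

lemma height_outer_at [simp]: "height (outer_at t n) = n"
  by (simp add: height_def outer_at_def)

lemma outer_at_height [simp]: "outer_at t (height t) = t"
  by (simp add: height_def outer_at_def)

lemma outer_at_step:
  "s \<noteq> 0 \<Longrightarrow> height s = Suc n \<or> n = Suc (height s) \<Longrightarrow> \<bar>s - outer_at s n\<bar> = 1"
  unfolding outer_at_def height_def by auto

lemma has_rung_outer_at: "has_rung (outer_at t n) \<longleftrightarrow> n = 0 \<or> (even n \<longleftrightarrow> 0 \<le> t)"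
  by (auto simp: has_rung_def outer_at_def)

lemma has_rung_climb: "\<not> has_rung (outer_at t i) \<Longrightarrow> has_rung (outer_at t (climb i n))"
  by (cases i) (auto simp: has_rung_outer_at climb_def)

lemma climb_step: "i \<noteq> n \<or> i \<noteq> 0 \<Longrightarrow> i = Suc (climb i n) \<or> climb i n = Suc i"
  by (auto simp: climb_def)

lemma gap_climb: "i \<noteq> n \<Longrightarrow> gap i n = Suc (gap (climb i n) n)"
  by (auto simp: climb_def gap_def)

lemma gap_climb_self: "n \<noteq> 0 \<Longrightarrow> gap (climb n n) n = 1"
  by (auto simp: climb_def gap_def)

lemma outer_dist_outer_at: "outer_dist (outer_at t i) t = gap i (height t)"
  by (cases "i = 0") (auto simp: outer_dist_same_side outer_at_def gap_def height_def)

lemma inner_outer_dist_inner_descent: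
  assumes "\<not> has_rung (outer_at t i)"
  shows "inner_outer_dist (climb i (height t)) t < inner_outer_dist i t"
proof -
  have "i \<noteq> 0"
    using assms by (auto simp: has_rung_outer_at)
  moreover have "has_rung t" if "climb i (height t) = height t"
    using has_rung_climb[OF assms, of "height t"] that by simp
  moreover have "\<not> has_rung t" if "i = height t"
    using assms that by simp
  ultimately show ?thesis
    using gap_climb[of i "height t"] gap_climb_self[of i]
    unfolding inner_outer_dist_def by (auto split: if_splits)
qed

lemma inner_outer_dist_outer_descent:
  assumes "\<not> has_rung s"
  shows "inner_outer_dist i (outer_at s (climb (height s) i)) < inner_outer_dist i s"
proof -
  have "has_rung (outer_at s (climb (height s) i))"
    by (rule has_rung_climb) (simp add: assms)
  moreover have "height s \<noteq> 0"
    using assms by auto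
  ultimately show ?thesis
    using gap_climb[of "height s" i] gap_climb_self[of "height s"] assms
    unfolding inner_outer_dist_def by (auto simp: gap_commute[of i])
qed

lemma crossing_dist_descent:
  assumes "0 \<le> s \<longleftrightarrow> \<not> 0 \<le> t" and "\<not> has_rung s"
  shows "crossing_dist (outer_at s (climb (height s) (height t))) t < crossing_dist s t"
proof -
  have rung: "has_rung (outer_at s (climb (height s) (height t)))"
    by (rule has_rung_climb) (simp add: assms)
  have rung_iff: "has_rung t \<longleftrightarrow> even (gap (height s) (height t))"
    using has_rung_iff_opposite_side[OF assms(1)] assms(2) by auto
  show ?thesis
  proof (cases "height s = height t")
    case True
    moreover have "height s \<noteq> 0"
      using assms(2) by auto
    ultimately have "gap (climb (height s) (height t)) (height t) = 1"
      by (simp add: gap_climb_self)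
    with True rung rung_iff assms(2) show ?thesis
      unfolding crossing_dist_def by simp
  next
    case False
    from gap_climb[OF False] rung rung_iff assms(2) show ?thesis
      unfolding crossing_dist_def by (auto simp: le_Suc_eq)
  qed
qed

lemma outer_dist_along_descent:
  "s \<noteq> t \<Longrightarrow> outer_dist (s + sgn (t - s)) t < nat \<bar>s - t\<bar>"
  using outer_dist_le[of "s + sgn (t - s)" t] by (auto simp: sgn_if)

lemma outer_dist_eq_crossing_dist:
  assumes "outer_dist s t \<noteq> nat \<bar>s - t\<bar>"
  shows "outer_dist s t = crossing_dist s t" and "0 \<le> s \<longleftrightarrow> \<not> 0 \<le> t"
  using assms outer_dist_same_side[of s t] by (auto simp: outer_dist_def min_def split: if_splits)

lemma outer_dist_climb_descent:
  assumes "outer_dist s t \<noteq> nat \<bar>s - t\<bar>" "\<not> has_rung s"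
  shows "outer_dist (outer_at s (climb (height s) (height t))) t < outer_dist s t"
  using crossing_dist_descent[of s t] outer_dist_eq_crossing_dist[OF assms(1)] assms(2)
  by (simp add: outer_dist_def)

lemma outer_dist_rung_descent:
  assumes "outer_dist s t \<noteq> nat \<bar>s - t\<bar>"
  shows "inner_outer_dist (height s) t < outer_dist s t"
  unfolding outer_dist_eq_crossing_dist(1)[OF assms]
  by (simp add: inner_outer_dist_def crossing_dist_def)

lemma height_along_le:
  "height s \<le> k \<Longrightarrow> height t \<le> k \<Longrightarrow> height (s + sgn (t - s)) \<le> k"
  by (auto simp: height_def sgn_if)

lemma toward_in_ladder_verts:
  assumes "u \<in> ladder_verts a k" "w \<in> ladder_verts a k" "u \<noteq> w"
  shows "toward u w \<in> ladder_verts a k"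
  using assms by (cases u; cases w) (auto simp: climb_def height_along_le)

lemma adj_toward:
  assumes "u \<noteq> w"
  shows "adj u (toward u w)"
proof -
  have "s \<noteq> 0" if "\<not> has_rung s" for s
    using that by auto
  moreover have "i \<noteq> 0" if "\<not> has_rung (outer_at t i)" for t i
    using that by (auto simp: has_rung_outer_at)
  ultimately show ?thesis
    using assms by (cases u; cases w) (auto simp: climb_step outer_at_step abs_sgn_eq)
qed

lemma dst_toward:
  assumes "u \<noteq> w"
  shows "dst (toward u w) w < dst u w"
proof -
  have "gap (height t) i < inner_outer_dist i t" for i t
    using gap_less_inner_outer_dist[of i t] by (simp add: gap_commute)
  with assms show ?thesis
    by (cases u; cases w)
      (auto simp: gap_climb gap_less_inner_outer_dist outer_dist_outer_at outer_dist_along_descent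
        inner_outer_dist_inner_descent inner_outer_dist_outer_descent outer_dist_rung_descent
        outer_dist_climb_descent)
qed

lemma graph_dist_ladder:
  assumes "u \<in> ladder_verts a k" "w \<in> ladder_verts a k"
  shows "graph_dist (with_proj (ladder a k)) u w = enat (dst u w)"
proof -
  interpret pair_graph "ladder a k" by (rule pair_graph_ladder)
  show ?thesis
  proof (rule graph_dist_eqI[where f = "\<lambda>u. dst u w"])
    fix e assume "e \<in> parcs (ladder a k)"
    then show "dst (fst e) w \<le> Suc (dst (snd e) w)"
      by (cases e) (simp add: parcs_ladder_iff dst_step)
  next
    fix v assume "v \<in> pverts (ladder a k)" "v \<noteq> w"
    with assms have "(v, toward v w) \<in> parcs (ladder a k)"
      by (simp add: parcs_ladder_iff toward_in_ladder_verts adj_toward)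
    with dst_toward[OF \<open>v \<noteq> w\<close>]
    show "\<exists>e\<in>parcs (ladder a k). fst e = v \<and> dst (snd e) w < dst v w"
      by force
  qed (simp_all add: assms)
qed

lemma connected_ladder: "Digraph_Component.connected (with_proj (ladder a k))"
proof -
  interpret pair_graph "ladder a k" by (rule pair_graph_ladder)
  have "ladder_verts a k \<noteq> {}"
    by (simp add: ladder_verts_def)
  then show ?thesis
    by (intro connected_if_graph_dist_finite) (simp_all add: graph_dist_ladder)
qed


section \<open>Resolving sets of the folded ladder\<close>

definition rails :: "vertex set" where
  "rails = range Inner \<union> range Outer"

lemma outer_dist_eq_gap:
  assumes "s = 0 \<or> t = 0 \<or> (0 \<le> s \<longleftrightarrow> 0 \<le> t)"
  shows "outer_dist s t = gap (height s) (height t)"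
proof (cases "0 \<le> s \<longleftrightarrow> 0 \<le> t")
  case True
  then show ?thesis
    by (simp add: outer_dist_same_side gap_height_same_side)
next
  case False
  with assms have "nat \<bar>s - t\<bar> = gap (height s) (height t)"
    by (auto simp: height_def)
  with gap_height_le_crossing_dist[of s t] show ?thesis
    by (simp add: outer_dist_def)
qed

lemma outer_dist_opposite_side_ge:
  assumes "s \<noteq> 0" "t \<noteq> 0" "0 \<le> s \<longleftrightarrow> \<not> 0 \<le> t"
  shows "gap (height s) (height t) + 2 \<le> outer_dist s t"
proof -
  have "gap (height s) (height t) + 2 \<le> nat \<bar>s - t\<bar>"
    using assms unfolding gap_height by linarith
  with gap_height_le_crossing_dist[of s t] show ?thesis
    by (simp add: outer_dist_def)
qed

lemma outer_dist_minus:
  assumes "s \<noteq> 0"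
  shows "outer_dist s (- s) = min (2 * height s) 4"
proof -
  have "nat \<bar>s - (- s)\<bar> = 2 * height s"
    unfolding height_def by linarith
  moreover have "crossing_dist s (- s) = 4"
    using assms by (simp add: crossing_dist_def has_rung_minus)
  ultimately show ?thesis
    by (simp only: outer_dist_def)
qed

lemma outer_dist_neq_outer_dist_minus:
  assumes "s \<noteq> 0" "t \<noteq> 0"
  shows "outer_dist s t \<noteq> outer_dist s (- t)"
proof (cases "0 \<le> s \<longleftrightarrow> 0 \<le> t")
  case True
  then have "0 \<le> s \<longleftrightarrow> \<not> 0 \<le> - t"
    using assms(2) by linarith
  then have "gap (height s) (height t) + 2 \<le> outer_dist s (- t)"
    using outer_dist_opposite_side_ge[of s "- t"] assms by simp
  with True show ?thesis
    by (simp add: outer_dist_eq_gap)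
next
  case False
  then have "0 \<le> s \<longleftrightarrow> 0 \<le> - t"
    using assms(2) by linarith
  then have "outer_dist s (- t) = gap (height s) (height t)"
    using outer_dist_eq_gap[of s "- t"] by simp
  moreover have "gap (height s) (height t) + 2 \<le> outer_dist s t"
    using False assms by (intro outer_dist_opposite_side_ge) auto
  ultimately show ?thesis by simp
qed

lemma inner_outer_dist_neq_outer_dist: "inner_outer_dist (height t) s \<noteq> outer_dist s t"
proof -
  consider (monotone) "s = 0 \<or> t = 0 \<or> (0 \<le> s \<longleftrightarrow> 0 \<le> t)"
    | (mirrored) "s \<noteq> 0" "t = - s"
    | (opposite_side) "s \<noteq> 0" "t \<noteq> 0" "0 \<le> s \<longleftrightarrow> \<not> 0 \<le> t" "height s \<noteq> height t"
    using height_eq_iff[of s t] by fastforce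
  then show ?thesis
  proof cases
    case monotone
    then show ?thesis
      using gap_less_inner_outer_dist[of "height t" s]
      by (simp add: outer_dist_eq_gap gap_commute)
  next
    case mirrored
    have "odd (inner_outer_dist (height s) s)"
      by (simp add: inner_outer_dist_def)
    moreover have "even (outer_dist s (- s))"
      using mirrored(1) by (simp add: outer_dist_minus min_def)
    ultimately show ?thesis
      using mirrored(2) by auto
  next
    case opposite_side
    then have "inner_outer_dist (height t) s = gap (height s) (height t) + 1"
      by (simp add: inner_outer_dist_def gap_commute)
    with outer_dist_opposite_side_ge[OF opposite_side(1-3)] show ?thesis by simp
  qed
qed

lemma dst_Twin_neq_Hub: "v \<in> rails \<Longrightarrow> dst v (Twin i) \<noteq> dst v Hub"
  by (auto simp: rails_def)

lemma dst_Inner_neq_Outer: "v \<in> rails \<Longrightarrow> dst v (Inner (height t)) \<noteq> dst v (Outer t)"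
  by (auto simp: rails_def inner_outer_dist_neq_outer_dist
      gap_less_inner_outer_dist[THEN less_imp_neq])

lemma dst_Outer_neq_iff:
  assumes "t \<noteq> 0"
  shows "dst v (Outer t) \<noteq> dst v (Outer (- t)) \<longleftrightarrow> v = Inner (height t) \<or> v \<in> Outer ` (- {0})"
proof (cases v)
  case (Inner i)
  then show ?thesis
    using assms by (cases "i = height t") (auto simp: inner_outer_dist_def has_rung_minus image_iff)
next
  case (Outer s)
  with outer_dist_neq_outer_dist_minus[OF _ assms, of s] show ?thesis
    by (cases "s = 0") (simp_all add: image_iff)
qed auto

lemma dst_Twin_eqE:
  assumes "dst (Twin c) x = dst (Twin c) y" "x \<noteq> y"
  obtains (twins) i j where "x = Twin i" "y = Twin j"
    | (twin_hub) i where "{x, y} = {Twin i, Hub}"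
    | (inner_outer) t where "{x, y} = {Inner (height t), Outer t}"
    | (mirrored) t where "x = Outer t" "y = Outer (- t)" "t \<noteq> 0"
  using assms by (cases x; cases y) (auto simp: height_eq_iff doubleton_eq_iff split: if_splits)

definition twins_except :: "nat \<Rightarrow> nat \<Rightarrow> vertex set" where
  "twins_except a c = Twin ` ({..<a} - {c})"

definition side_resolvers :: "nat \<Rightarrow> vertex set set" where
  "side_resolvers k = insert (Inner ` {1..k}) ((\<lambda>t. {Outer t}) ` {t. t \<noteq> 0 \<and> height t \<le> k})"

definition ladder_generators :: "nat \<Rightarrow> nat \<Rightarrow> vertex set set" where
  "ladder_generators a k = {twins_except a c \<union> Q | c Q. c < a \<and> Q \<in> side_resolvers k}"

lemma side_resolver_subset_rails: "Q \<in> side_resolvers k \<Longrightarrow> Q \<subseteq> rails"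
  by (auto simp: side_resolvers_def rails_def)

lemma twins_except_inter_side_resolver:
  "Q \<in> side_resolvers k \<Longrightarrow> twins_except a c \<inter> Q = {}"
  by (auto simp: twins_except_def side_resolvers_def)

lemma resolving_set_ladder_iff:
  "resolving_set (with_proj (ladder a k)) S \<longleftrightarrow> S \<subseteq> ladder_verts a k \<and>
    (\<forall>x\<in>ladder_verts a k. \<forall>y\<in>ladder_verts a k. x \<noteq> y \<longrightarrow> (\<exists>w\<in>S. dst w x \<noteq> dst w y))"
proof (cases "S \<subseteq> ladder_verts a k")
  case True
  then have "resolves (with_proj (ladder a k)) w x y \<longleftrightarrow> dst w x \<noteq> dst w y"
    if "w \<in> S" "x \<in> ladder_verts a k" "y \<in> ladder_verts a k" for w x y
    using that by (auto simp: resolves_def graph_dist_ladder subset_iff)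
  with True show ?thesis
    by (simp add: resolving_set_def)
qed (simp add: resolving_set_def)

lemma resolving_set_ladderE:
  assumes "resolving_set (with_proj (ladder a k)) S"
    and "x \<in> ladder_verts a k" "y \<in> ladder_verts a k" "x \<noteq> y"
  obtains w where "w \<in> S" "w \<in> ladder_verts a k" "dst w x \<noteq> dst w y"
  using assms unfolding resolving_set_ladder_iff by blast

lemma resolving_set_contains_twins:
  assumes "resolving_set (with_proj (ladder a k)) S" "0 < a"
  shows "\<exists>c<a. twins_except a c \<subseteq> S"
proof -
  have twins: "Twin i \<in> S \<or> Twin j \<in> S" if ij: "i < a" "j < a" "i \<noteq> j" for i j
  proof -
    obtain w where "w \<in> S" "dst w (Twin i) \<noteq> dst w (Twin j)"
      using resolving_set_ladderE[OF assms(1), of "Twin i" "Twin j"] ij by auto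
    then show ?thesis by (cases w) (auto split: if_splits)
  qed
  show ?thesis
  proof (cases "Twin ` {..<a} \<subseteq> S")
    case True
    with assms(2) show ?thesis by (intro exI[of _ 0]) (auto simp: twins_except_def)
  next
    case False
    then obtain c where "c < a" "Twin c \<notin> S" by auto
    with twins[of c] show ?thesis by (intro exI[of _ c]) (auto simp: twins_except_def)
  qed
qed

lemma resolving_set_contains_side_resolver:
  assumes "resolving_set (with_proj (ladder a k)) S"
  shows "\<exists>Q\<in>side_resolvers k. Q \<subseteq> S"
proof (cases "Inner ` {1..k} \<subseteq> S")
  case True
  then show ?thesis by (auto simp: side_resolvers_def)
next
  case False
  then obtain i where i: "1 \<le> i" "i \<le> k" "Inner i \<notin> S"
    by (auto simp: image_subset_iff)
  let ?t = "int i"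
  have "height ?t = i" by (simp add: height_def)
  with i obtain w where "w \<in> S" "w \<in> ladder_verts a k" "dst w (Outer ?t) \<noteq> dst w (Outer (- ?t))"
    using resolving_set_ladderE[OF assms, of "Outer ?t" "Outer (- ?t)"] by auto
  with i \<open>height ?t = i\<close> have "w \<in> Outer ` (- {0})"
    using dst_Outer_neq_iff[of ?t w] by auto
  then obtain t where "t \<noteq> 0" "w = Outer t" by auto
  moreover have "height t \<le> k"
    using \<open>w \<in> ladder_verts a k\<close> \<open>w = Outer t\<close> by simp
  ultimately show ?thesis
    using \<open>w \<in> S\<close> by (auto simp: side_resolvers_def)
qed

lemma side_resolver_resolves:
  assumes "1 \<le> k" and Q: "Q \<in> side_resolvers k"
    and "x \<in> ladder_verts a k" "x \<noteq> y" "x \<notin> range Twin \<or> y \<notin> range Twin"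
    and "dst (Twin c) x = dst (Twin c) y"
  shows "\<exists>w\<in>Q. dst w x \<noteq> dst w y"
proof -
  have "Q \<noteq> {}"
    using assms(1) Q by (auto simp: side_resolvers_def)
  then obtain v where "v \<in> Q" "v \<in> rails"
    using side_resolver_subset_rails[OF Q] by blast
  from assms(6,4) show ?thesis
  proof (cases rule: dst_Twin_eqE)
    case (twins i j)
    with assms(5) show ?thesis by blast
  next
    case (twin_hub i)
    with \<open>v \<in> Q\<close> dst_Twin_neq_Hub[OF \<open>v \<in> rails\<close>, of i] show ?thesis
      unfolding doubleton_eq_iff by metis
  next
    case (inner_outer t)
    with \<open>v \<in> Q\<close> dst_Inner_neq_Outer[OF \<open>v \<in> rails\<close>, of t] show ?thesis
      unfolding doubleton_eq_iff by metis
  next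
    case (mirrored t)
    with assms(3) have "1 \<le> height t" "height t \<le> k"
      by (auto simp: Suc_le_eq)
    with Q have "\<exists>w\<in>Q. w = Inner (height t) \<or> w \<in> Outer ` (- {0})"
      by (auto simp: side_resolvers_def)
    then show ?thesis
      unfolding mirrored(1,2) dst_Outer_neq_iff[OF mirrored(3)] .
  qed
qed

lemma resolving_set_ladderI:
  assumes "2 \<le> a" "1 \<le> k" "S \<subseteq> ladder_verts a k"
    and twins: "twins_except a c \<subseteq> S"
    and sides: "Q \<in> side_resolvers k" "Q \<subseteq> S"
  shows "resolving_set (with_proj (ladder a k)) S"
  unfolding resolving_set_ladder_iff
proof (intro conjI ballI impI)
  fix x y assume xy: "x \<in> ladder_verts a k" "y \<in> ladder_verts a k" "x \<noteq> y"
  obtain d where "d < a" "d \<noteq> c"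
    using \<open>2 \<le> a\<close> by (intro that[of "if c = 0 then 1 else 0"]) auto
  with twins have "Twin d \<in> S" by (auto simp: twins_except_def)
  consider (twins) i j where "x = Twin i" "y = Twin j"
    | (level) "dst (Twin d) x \<noteq> dst (Twin d) y"
    | (same_level) "dst (Twin d) x = dst (Twin d) y" "x \<notin> range Twin \<or> y \<notin> range Twin"
    by blast
  then show "\<exists>w\<in>S. dst w x \<noteq> dst w y"
  proof cases
    case (twins i j)
    with xy \<open>twins_except a c \<subseteq> S\<close> have "Twin i \<in> S \<or> Twin j \<in> S"
      by (auto simp: twins_except_def)
    with twins xy(3) show ?thesis by (metis dst.simps(1) zero_neq_one)
  next
    case level
    with \<open>Twin d \<in> S\<close> show ?thesis by blast
  next
    case same_level
    with side_resolver_resolves[OF assms(2) sides(1) xy(1,3)] sides(2) show ?thesis by blast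
  qed
qed (rule assms(3))

lemma ladder_generator_subset: "B \<in> ladder_generators a k \<Longrightarrow> B \<subseteq> ladder_verts a k"
  by (auto simp: ladder_generators_def twins_except_def side_resolvers_def)

lemma resolving_sets_ladder_generated:
  assumes "2 \<le> a" "1 \<le> k"
  shows "resolving_sets_generated_by (with_proj (ladder a k)) (ladder_generators a k)"
proof -
  have "resolving_set (with_proj (ladder a k)) S \<longleftrightarrow>
      S \<subseteq> ladder_verts a k \<and> (\<exists>B\<in>ladder_generators a k. B \<subseteq> S)" for S
  proof
    assume S: "resolving_set (with_proj (ladder a k)) S"
    then obtain c Q where "c < a" "twins_except a c \<subseteq> S" "Q \<in> side_resolvers k" "Q \<subseteq> S"
      using resolving_set_contains_twins[OF S] resolving_set_contains_side_resolver[OF S] assms(1)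
      by auto
    then have "twins_except a c \<union> Q \<in> ladder_generators a k" "twins_except a c \<union> Q \<subseteq> S"
      by (auto simp: ladder_generators_def)
    moreover have "S \<subseteq> ladder_verts a k"
      using S by (simp add: resolving_set_ladder_iff)
    ultimately show "S \<subseteq> ladder_verts a k \<and> (\<exists>B\<in>ladder_generators a k. B \<subseteq> S)"
      by blast
  next
    assume "S \<subseteq> ladder_verts a k \<and> (\<exists>B\<in>ladder_generators a k. B \<subseteq> S)"
    then show "resolving_set (with_proj (ladder a k)) S"
      using resolving_set_ladderI[OF assms] by (auto simp: ladder_generators_def)
  qed
  moreover have "ladder_generators a k \<subseteq> Pow (ladder_verts a k)"
    using ladder_generator_subset by blast
  ultimately show ?thesis
    by (simp add: resolving_sets_generated_by_def)
qed

lemma ladder_generators_antichain: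
  assumes "1 \<le> k" "B \<in> ladder_generators a k" "C \<in> ladder_generators a k" "B \<subseteq> C"
  shows "B = C"
proof -
  obtain c Q where B: "B = twins_except a c \<union> Q" "c < a" "Q \<in> side_resolvers k"
    using assms(2) by (auto simp: ladder_generators_def)
  obtain d R where C: "C = twins_except a d \<union> R" "d < a" "R \<in> side_resolvers k"
    using assms(3) by (auto simp: ladder_generators_def)
  have "twins_except a c \<subseteq> twins_except a d"
    using assms(4) twins_except_inter_side_resolver[OF C(3)] unfolding B C by blast
  with B(2) C(2) have "c = d"
    by (auto simp: twins_except_def)
  moreover have "Q \<subseteq> R"
    using assms(4) twins_except_inter_side_resolver[OF B(3)] unfolding B C by blast
  then have "Q = R"
    using B(3) C(3) assms(1) by (auto simp: side_resolvers_def image_subset_iff)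
  ultimately show ?thesis
    using B(1) C(1) by simp
qed

lemma card_twins_except_Un_side_resolver:
  assumes "c < a" "Q \<in> side_resolvers k"
  shows "card (twins_except a c \<union> Q) = a - 1 + card Q"
proof -
  have "finite Q"
    using assms(2) by (auto simp: side_resolvers_def)
  moreover have "finite (twins_except a c)" "card (twins_except a c) = a - 1"
    using assms(1) by (simp_all add: twins_except_def card_image inj_on_def)
  ultimately show ?thesis
    using twins_except_inter_side_resolver[OF assms(2)] by (simp add: card_Un_disjoint)
qed

lemma card_side_resolvers:
  assumes "1 \<le> k"
  shows "card ` side_resolvers k = {1, k}"
proof -
  have "{t. t \<noteq> 0 \<and> height t \<le> k} \<noteq> {}"
    using assms by (auto simp: height_def intro: exI[of _ 1])
  then show ?thesis
    by (auto simp: side_resolvers_def card_image inj_on_def image_image image_constant_conv)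
qed

lemma card_ladder_generators:
  assumes "1 \<le> a" "1 \<le> k"
  shows "card ` ladder_generators a k = {a, a - 1 + k}"
proof -
  have "card ` ladder_generators a k
      = {card (twins_except a c \<union> Q) | c Q. c < a \<and> Q \<in> side_resolvers k}"
    by (auto simp: ladder_generators_def)
  also have "\<dots> = {a - 1 + card Q | c Q. c < a \<and> Q \<in> side_resolvers k}"
    using card_twins_except_Un_side_resolver by (metis (no_types, opaque_lifting))
  also have "\<dots> = (+) (a - 1) ` card ` side_resolvers k"
    using assms(1) by (auto intro!: exI[of _ 0])
  also have "\<dots> = {a, a - 1 + k}"
    using assms(1) by (simp add: card_side_resolvers[OF assms(2)])
  finally show ?thesis .
qed

lemma metric_dim_ladder:
  assumes "2 \<le> a" "1 \<le> k"
  shows "metric_dim (with_proj (ladder a k)) = a"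
proof -
  have "card ` ladder_generators a k = {a, a - 1 + k}"
    using assms by (intro card_ladder_generators) auto
  moreover from this have "ladder_generators a k \<noteq> {}" by auto
  ultimately show ?thesis
    using metric_dim_eq_Min_generators[OF resolving_sets_ladder_generated[OF assms]] assms(2)
    by (simp add: finite_ladder_verts)
qed

lemma upper_dim_ladder:
  assumes "2 \<le> a" "1 \<le> k"
  shows "upper_dim (with_proj (ladder a k)) = a - 1 + k"
proof -
  have "card ` ladder_generators a k = {a, a - 1 + k}"
    using assms by (intro card_ladder_generators) auto
  then show ?thesis
    using upper_dim_eq_Max_generators[OF resolving_sets_ladder_generated[OF assms]
        ladder_generators_antichain[OF assms(2)]] assms(2)
    by simp
qed

theorem theorem3p5:
  fixes a b :: nat
  assumes "2 \<le> a" and "a \<le> b"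
  shows "\<exists>G :: nat pair_pre_digraph. pair_graph G \<and> Digraph_Component.connected (with_proj G) \<and>
    metric_dim (with_proj G) = a \<and> upper_dim (with_proj G) = b"
proof -
  define k where "k = b - a + 1"
  have k: "1 \<le> k" "a - 1 + k = b"
    using assms by (auto simp: k_def)
  obtain G :: "nat pair_pre_digraph" where "pair_graph G"
      and iso: "digraph_iso (with_proj (ladder a k)) (with_proj G)"
    using ex_iso_nat_pair_graph[OF pair_graph_ladder] by blast
  interpret ladder: pair_graph "ladder a k" by (rule pair_graph_ladder)
  have "Digraph_Component.connected (with_proj G)"
    using iso ladder.connectedI_app_iso[OF connected_ladder] by (auto simp: digraph_iso_def)
  moreover have "metric_dim (with_proj G) = a"
    using ladder.metric_dim_digraph_iso[OF iso] metric_dim_ladder[OF assms(1) k(1)] by simp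
  moreover have "upper_dim (with_proj G) = b"
    using ladder.upper_dim_digraph_iso[OF iso] upper_dim_ladder[OF assms(1) k(1)] k(2) by simp
  ultimately show ?thesis
    using \<open>pair_graph G\<close> by blast
qed

end
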